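(* Let $\mathbb{K}$ be a field. There exist $n,m\ge 1$ and an ideal $\mathfrak{I}\subset\mathbb{K}[x_1,\ldots,x_n,u_1,\ldots,u_m]$ which has an $\mathfrak{I}$-specific elimination order $\prec$ for the elimination of $u_1,\ldots,u_m$ whose Gröbner cone $C_\prec(\mathfrak{I})$ intersects the boundary of the Gröbner fan of $\mathfrak{I}$ in the origin $0$ only.
   Context: Write $\mathbb{K}[X]=\mathbb{K}[x_1,\ldots,x_n]$, $\mathbb{K}[X][U]=\mathbb{K}[x_1,\ldots,x_n,u_1,\ldots,u_m]$, and $(y_1,\ldots,y_{n+m})=(x_1,\ldots,x_n,u_1,\ldots,u_m)$; for $\alpha\in\mathbb{N}^{n+m}$ put $y^\alpha=\prod_i y_i^{\alpha_i}$. For a monomial order $\prec$ on $\mathbb{K}[X][U]$, $\mathrm{lt}_\prec(f)$ is the leading term of $f\neq 0$, and $\langle \mathrm{lt}_\prec(\mathfrak{I})\rangle$ is the ideal generated by all leading terms of nonzero elements of $\mathfrak{I}$. A Gröbner basis $G$ is reduced if for all $g\ne h$ in $G$, $\mathrm{lt}_\prec(g)$ divides no monomial of $h$; it is normed if all leading coefficients are $1$. $\underline{GB}(\mathfrak{I},\prec)$ denotes the unique finite normed reduced Gröbner basis of $\mathfrak{I}$ with respect to $\prec$. Weight vectors are the elements of $\Omega:=\mathbb{R}^{n+m}_{\ge 0}$. For $f=\sum_\alpha f_\alpha y^\alpha\ne 0$ and $\omega\in\Omega$, $\deg_\omega(f):=\max\{\omega^T\alpha : f_\alpha\ne0\}$,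 and $\mathrm{lt}_\omega(f):=\sum_{\alpha\in A} f_\alpha y^\alpha$ with $A=\{\alpha\in\mathbb{N}^{n+m}: f_\alpha\neq 0,\ \omega^T\alpha=\deg_\omega(f)\}$. $\langle\mathrm{lt}_\omega(\mathfrak{I})\rangle$ is the ideal generated by all $\mathrm{lt}_\omega(f)$, $0\neq f\in\mathfrak{I}$. The Gröbner cone of $\mathfrak{I}$ with respect to $\prec$ is $C_\prec(\mathfrak{I}):=\mathrm{closure}(\{\omega\in\Omega : \langle\mathrm{lt}_\omega(\mathfrak{I})\rangle=\langle\mathrm{lt}_\prec(\mathfrak{I})\rangle\})$, closure in the standard topology of $\mathbb{R}^{n+m}$. The Gröbner fan of $\mathfrak{I}$ is the polyhedral complex $\{C_\prec(\mathfrak{I}) : \prec\text{ a monomial order}\}$; it subdivides $\Omega$, so its boundary is the topological boundary of $\Omega=\mathbb{R}^{n+m}_{\ge0}$ in $\mathbb{R}^{n+m}$, i.e. the set of $\omega\in\Omega$ with at least one zero coordinate. A monomial order $\prec$ is an $\mathfrak{I}$-specific elimination order for the elimination of $u_1,\ldots,u_m$ if for all $g\in\underline{GB}(\mathfrak{I},\prec)$: $\mathrm{lt}_\prec(g)\in\mathbb{K}[X]$ implies $g\in\mathbb{K}[X]$. *)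

theory Defs
  imports
    "HOL-Analysis.Analysis"
    "HOL-Algebra.Ideal"
    "HOL-Algebra.Divisibility"
    "HOL-Library.Poly_Mapping"
begin

text \<open>
  The polynomial ring in \<open>N\<close> variables lives inside the polynomials in countably many
  variables \<open>y\<^sub>0, y\<^sub>1, \<dots>\<close>: an exponent \<open>\<alpha>\<close> is a finitely supported function from variables
  to naturals, and a polynomial is a finitely supported function from exponents to coefficients.
  In the ring with \<open>N = n + m\<close>, the variables \<open>y\<^sub>i\<close> with \<open>i < n\<close> play the role of
  the \<open>x\<close>-variables and those with \<open>n \<le> i < n + m\<close> that of the \<open>u\<close>-variables.
  Hence \<open>carrier (mpoly_ring n)\<close> is \<open>K[X]\<close> as a subset of \<open>K[X][U]\<close>.
\<close>

type_synonym expo = "nat \<Rightarrow>\<^sub>0 nat"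
type_synonym 'a mpoly = "expo \<Rightarrow>\<^sub>0 'a"

definition expos :: "nat \<Rightarrow> expo set" where
  "expos N = {\<alpha>. Poly_Mapping.keys \<alpha> \<subseteq> {..<N}}"

definition mpoly_ring :: "nat \<Rightarrow> 'a::field mpoly ring" where
  "mpoly_ring N =
    \<lparr>carrier = {f. Poly_Mapping.keys f \<subseteq> expos N}, mult = (*), one = 1, zero = 0, add = (+)\<rparr>"

lemma expos_zero: "0 \<in> expos N"
  by (simp add: expos_def)

lemma expos_add: "\<alpha> \<in> expos N \<Longrightarrow> \<beta> \<in> expos N \<Longrightarrow> \<alpha> + \<beta> \<in> expos N"
  using Poly_Mapping.keys_add[of \<alpha> \<beta>] by (auto simp: expos_def)

lemma mpoly_ring_cring: "cring (mpoly_ring N :: 'a::field mpoly ring)"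
proof (rule cringI)
  have add: "f + g \<in> carrier (mpoly_ring N)"
    if "f \<in> carrier (mpoly_ring N)" "g \<in> carrier (mpoly_ring N)" for f g :: "'a mpoly"
    using that Poly_Mapping.keys_add[of f g] by (auto simp: mpoly_ring_def)
  have mult: "f * g \<in> carrier (mpoly_ring N)"
    if "f \<in> carrier (mpoly_ring N)" "g \<in> carrier (mpoly_ring N)" for f g :: "'a mpoly"
  proof -
    have "a + b \<in> expos N" if "a \<in> Poly_Mapping.keys f" "b \<in> Poly_Mapping.keys g" for a b
      using that \<open>f \<in> _\<close> \<open>g \<in> _\<close> by (auto simp: mpoly_ring_def intro!: expos_add)
    then have "Poly_Mapping.keys (f * g) \<subseteq> expos N"
      using Poly_Mapping.keys_mult[of f g] by blast
    then show ?thesis by (simp add: mpoly_ring_def)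
  qed
  have uminus: "- f \<in> carrier (mpoly_ring N)"
    if "f \<in> carrier (mpoly_ring N)" for f :: "'a mpoly"
    using that by (auto simp: mpoly_ring_def)
  show "abelian_group (mpoly_ring N :: 'a mpoly ring)"
  proof (rule abelian_groupI)
    fix f :: "'a mpoly" assume "f \<in> carrier (mpoly_ring N)"
    then show "\<exists>g\<in>carrier (mpoly_ring N). g \<oplus>\<^bsub>mpoly_ring N\<^esub> f = \<zero>\<^bsub>mpoly_ring N\<^esub>"
      by (intro bexI[of _ "- f"] uminus) (simp_all add: mpoly_ring_def)
  next
    fix f g :: "'a mpoly"
    assume "f \<in> carrier (mpoly_ring N)" "g \<in> carrier (mpoly_ring N)"
    then show "f \<oplus>\<^bsub>mpoly_ring N\<^esub> g \<in> carrier (mpoly_ring N)"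
      using add by (simp add: mpoly_ring_def)
  qed (simp_all add: mpoly_ring_def ac_simps)
  show "comm_monoid (mpoly_ring N :: 'a mpoly ring)"
  proof (rule comm_monoidI)
    fix f g :: "'a mpoly"
    assume "f \<in> carrier (mpoly_ring N)" "g \<in> carrier (mpoly_ring N)"
    then show "f \<otimes>\<^bsub>mpoly_ring N\<^esub> g \<in> carrier (mpoly_ring N)"
      using mult by (simp add: mpoly_ring_def)
  qed (simp_all add: mpoly_ring_def expos_zero ac_simps)
qed (simp add: mpoly_ring_def distrib_right)

text \<open>
  Orders are given, as in \<^theory>\<open>HOL.Order_Relation\<close>, by their reflexive relation:
  \<open>(\<alpha>, \<beta>) \<in> r\<close> means \<open>y\<^sup>\<alpha> \<preceq> y\<^sup>\<beta>\<close>.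
\<close>

definition monomial_order :: "nat \<Rightarrow> expo rel \<Rightarrow> bool" where
  "monomial_order N r \<longleftrightarrow> well_order_on (expos N) r \<and>
    (\<forall>\<alpha>\<in>expos N. \<forall>\<beta>\<in>expos N. \<forall>\<gamma>\<in>expos N. (\<alpha>, \<beta>) \<in> r \<longrightarrow> (\<alpha> + \<gamma>, \<beta> + \<gamma>) \<in> r)"

text \<open>The next three notions are meaningful for \<open>f \<noteq> 0\<close> only.\<close>

definition lead_expo :: "expo rel \<Rightarrow> 'a::field mpoly \<Rightarrow> expo" where
  "lead_expo r f =
    (THE \<alpha>. \<alpha> \<in> Poly_Mapping.keys f \<and> (\<forall>\<beta>\<in>Poly_Mapping.keys f. (\<beta>, \<alpha>) \<in> r))"

definition lead_coef :: "expo rel \<Rightarrow> 'a::field mpoly \<Rightarrow> 'a" where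
  "lead_coef r f = Poly_Mapping.lookup f (lead_expo r f)"

definition lead_term :: "expo rel \<Rightarrow> 'a::field mpoly \<Rightarrow> 'a mpoly" where
  "lead_term r f = Poly_Mapping.single (lead_expo r f) (lead_coef r f)"

definition lead_ideal :: "nat \<Rightarrow> expo rel \<Rightarrow> 'a::field mpoly set \<Rightarrow> 'a mpoly set" where
  "lead_ideal N r I = Idl\<^bsub>mpoly_ring N\<^esub> (lead_term r ` (I - {0}))"

definition groebner_basis :: "nat \<Rightarrow> expo rel \<Rightarrow> 'a::field mpoly set \<Rightarrow> 'a mpoly set \<Rightarrow> bool" where
  "groebner_basis N r I G \<longleftrightarrow>
    finite G \<and> G \<subseteq> I \<and> Idl\<^bsub>mpoly_ring N\<^esub> (lead_term r ` (G - {0})) = lead_ideal N r I"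

definition reduced :: "nat \<Rightarrow> expo rel \<Rightarrow> 'a::field mpoly set \<Rightarrow> bool" where
  "reduced N r G \<longleftrightarrow> (\<forall>g\<in>G. \<forall>h\<in>G. g \<noteq> h \<longrightarrow>
    (\<forall>\<beta>\<in>Poly_Mapping.keys h.
      \<not> lead_term r g divides\<^bsub>mpoly_ring N\<^esub> (Poly_Mapping.single \<beta> 1)))"

text \<open>
  A normed set does not contain \<open>0\<close>, all of whose coefficients vanish; without this the
  reduced normed basis below would not be unique.
\<close>

definition normed :: "expo rel \<Rightarrow> 'a::field mpoly set \<Rightarrow> bool" where
  "normed r G \<longleftrightarrow> (\<forall>g\<in>G. lead_coef r g = 1)"

definition GB :: "nat \<Rightarrow> expo rel \<Rightarrow> 'a::field mpoly set \<Rightarrow> 'a mpoly set" where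
  "GB N r I = (THE G. groebner_basis N r I G \<and> reduced N r G \<and> normed r G)"

text \<open>
  Vectors of \<open>\<real>\<^sup>N\<close> are functions on \<^typ>\<open>nat\<close> that vanish from \<open>N\<close> on, the points of
  \<^const>\<open>Euclidean_space\<close>.
\<close>

definition weights :: "nat \<Rightarrow> (nat \<Rightarrow> real) set" where
  "weights N = {\<omega> \<in> topspace (Euclidean_space N). \<forall>i<N. 0 \<le> \<omega> i}"

definition weight :: "nat \<Rightarrow> (nat \<Rightarrow> real) \<Rightarrow> expo \<Rightarrow> real" where
  "weight N \<omega> \<alpha> = (\<Sum>i<N. \<omega> i * real (Poly_Mapping.lookup \<alpha> i))"

definition wdeg :: "nat \<Rightarrow> (nat \<Rightarrow> real) \<Rightarrow> 'a::field mpoly \<Rightarrow> real" where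
  "wdeg N \<omega> f = Max (weight N \<omega> ` Poly_Mapping.keys f)"

definition wlead_form :: "nat \<Rightarrow> (nat \<Rightarrow> real) \<Rightarrow> 'a::field mpoly \<Rightarrow> 'a mpoly" where
  "wlead_form N \<omega> f =
    (\<Sum>\<alpha> | \<alpha> \<in> Poly_Mapping.keys f \<and> weight N \<omega> \<alpha> = wdeg N \<omega> f.
      Poly_Mapping.single \<alpha> (Poly_Mapping.lookup f \<alpha>))"

definition wlead_ideal :: "nat \<Rightarrow> (nat \<Rightarrow> real) \<Rightarrow> 'a::field mpoly set \<Rightarrow> 'a mpoly set" where
  "wlead_ideal N \<omega> I = Idl\<^bsub>mpoly_ring N\<^esub> (wlead_form N \<omega> ` (I - {0}))"

definition groebner_cone :: "nat \<Rightarrow> expo rel \<Rightarrow> 'a::field mpoly set \<Rightarrow> (nat \<Rightarrow> real) set" where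
  "groebner_cone N r I =
    Euclidean_space N closure_of {\<omega> \<in> weights N. wlead_ideal N \<omega> I = lead_ideal N r I}"

definition groebner_fan :: "nat \<Rightarrow> 'a::field mpoly set \<Rightarrow> (nat \<Rightarrow> real) set set" where
  "groebner_fan N I = {groebner_cone N r I | r. monomial_order N r}"

text \<open>
  The boundary of a polyhedral complex is the topological boundary of its support. As the
  Groebner fan subdivides \<^term>\<open>weights N\<close>, this is the set of all weight vectors with at
  least one zero coordinate.
\<close>

definition fan_boundary :: "nat \<Rightarrow> (nat \<Rightarrow> real) set set \<Rightarrow> (nat \<Rightarrow> real) set" where
  "fan_boundary N F = Euclidean_space N frontier_of (\<Union>F)"

definition specific_elimination_order ::
    "nat \<Rightarrow> nat \<Rightarrow> 'a::field mpoly set \<Rightarrow> expo rel \<Rightarrow> bool" where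
  "specific_elimination_order n m I r \<longleftrightarrow> monomial_order (n + m) r \<and>
    (\<forall>g\<in>GB (n + m) r I.
      lead_term r g \<in> carrier (mpoly_ring n) \<longrightarrow> g \<in> carrier (mpoly_ring n))"

end

theory Submission
  imports Defs
begin

text \<open>
  With one variable \<open>x\<close> and one variable \<open>u\<close>, the principal ideal generated by
  \<open>f = x\<^sup>2u\<^sup>2 + x\<^sup>3 + u\<^sup>3\<close> has the required property. The exponents \<open>(2,2)\<close>, \<open>(3,0)\<close>, \<open>(0,3)\<close>
  are the vertices of a triangle: \<open>(2,2)\<close> lies beyond the line through the other two, but each of
  these exceeds it in one coordinate. Comparing weights shows that
  \<open>x\<^sup>2u\<^sup>2\<close> is the leading term for the weights \<open>(a, b)\<close> with \<open>a < 2b\<close> and \<open>b < 2a\<close>, and the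
  closure of this set meets the coordinate axes in the origin only. Near the axes one of the
  pure powers takes over: it is \<open>x\<^sup>3\<close> for \<open>a > 2b\<close> and \<open>u\<^sup>3\<close> for \<open>b > 2a\<close>. The reduced basis of a
  principal ideal consists of its monic generator, so an order with leading term \<open>x\<^sup>2u\<^sup>2\<close> is a
  specific elimination order for a trivial reason: the only basis element has a leading term that
  involves \<open>u\<close>.

  Two facts make the computation short. Leading forms are multiplicative
  (\<open>wlead_form_mult\<close>), so the leading forms of a principal ideal generate the
  principal ideal of the leading form of its generator (\<open>wlead_ideal_PIdl\<close>). And a
  positive weight vector that separates all exponents is itself a monomial order
  (\<open>monomial_order_weight_order\<close>) whose leading terms are its leading forms, so
  that nothing has to be proved twice, once for orders and once for weights. Therefore the open
  cone of such an order is cut out by the inequalities which say that its leading exponent has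
  maximal weight among the exponents of \<open>f\<close> (\<open>open_cone_PIdl\<close>).

  In two variables the weight \<open>(s, 1)\<close> separates the exponents when \<open>s\<close> is irrational. Irrational
  slopes in the intervals \<open>(0, 1/2)\<close>, \<open>(1/2, 2)\<close> and above \<open>2\<close> yield three orders whose cones cover
  the quadrant. The support of the fan is thus exactly the quadrant, and its boundary is the set
  of weights with a zero coordinate (\<open>frontier_of_weights\<close>).
\<close>

section \<open>Leading forms\<close>

lemma mem_carrier: "f \<in> carrier (mpoly_ring N) \<longleftrightarrow> Poly_Mapping.keys f \<subseteq> expos N"
  by (simp add: mpoly_ring_def)

lemma PIdl_mpoly_ring: "PIdl\<^bsub>mpoly_ring N\<^esub> f = (\<lambda>g. g * f) ` carrier (mpoly_ring N)"
  by (auto simp: cgenideal_def mpoly_ring_def)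

lemma weight_add: "weight N \<omega> (\<alpha> + \<beta>) = weight N \<omega> \<alpha> + weight N \<omega> \<beta>"
  by (simp add: weight_def lookup_add distrib_left sum.distrib)

lemma weight_ge_summand:
  assumes "\<And>j. j < N \<Longrightarrow> 0 \<le> \<omega> j" "i < N"
  shows "\<omega> i * real (Poly_Mapping.lookup \<alpha> i) \<le> weight N \<omega> \<alpha>"
  unfolding weight_def using assms by (intro member_le_sum) auto

lemma weight_le_wdeg: "\<alpha> \<in> Poly_Mapping.keys f \<Longrightarrow> weight N \<omega> \<alpha> \<le> wdeg N \<omega> f"
  by (simp add: wdeg_def)

lemma wdeg_attained:
  assumes "f \<noteq> 0"
  obtains \<alpha> where "\<alpha> \<in> Poly_Mapping.keys f" "weight N \<omega> \<alpha> = wdeg N \<omega> f"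
proof -
  have "wdeg N \<omega> f \<in> weight N \<omega> ` Poly_Mapping.keys f"
    unfolding wdeg_def using assms by (intro Max_in) auto
  then show ?thesis using that by auto
qed

lemma lookup_wlead_form:
  "Poly_Mapping.lookup (wlead_form N \<omega> f) \<alpha> =
    (if weight N \<omega> \<alpha> = wdeg N \<omega> f then Poly_Mapping.lookup f \<alpha> else 0)"
proof -
  have "Poly_Mapping.lookup (wlead_form N \<omega> f) \<alpha> =
    (\<Sum>\<beta> | \<beta> \<in> Poly_Mapping.keys f \<and> weight N \<omega> \<beta> = wdeg N \<omega> f.
      if \<alpha> = \<beta> then Poly_Mapping.lookup f \<beta> else 0)"
    unfolding wlead_form_def lookup_sum by (intro sum.cong) (auto simp: lookup_single when_def)
  also have "\<dots> = (if weight N \<omega> \<alpha> = wdeg N \<omega> f then Poly_Mapping.lookup f \<alpha> else 0)"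
    by (subst sum.delta') (auto simp: in_keys_iff)
  finally show ?thesis .
qed

lemma keys_wlead_form:
  "Poly_Mapping.keys (wlead_form N \<omega> f) =
    {\<alpha> \<in> Poly_Mapping.keys f. weight N \<omega> \<alpha> = wdeg N \<omega> f}"
  by (auto simp: in_keys_iff lookup_wlead_form split: if_splits)

lemma wlead_form_nonzero: "f \<noteq> 0 \<Longrightarrow> wlead_form N \<omega> f \<noteq> 0"
  using wdeg_attained[of f N \<omega>] keys_wlead_form[of N \<omega> f] by fastforce

lemma wlead_form_carrier:
  "f \<in> carrier (mpoly_ring M) \<Longrightarrow> wlead_form N \<omega> f \<in> carrier (mpoly_ring M)"
  by (auto simp: mem_carrier keys_wlead_form)

lemma wlead_form_add_lower:
  assumes "p \<noteq> 0" and p: "\<And>\<alpha>. \<alpha> \<in> Poly_Mapping.keys p \<Longrightarrow> weight N \<omega> \<alpha> = d"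
    and q: "\<And>\<alpha>. \<alpha> \<in> Poly_Mapping.keys q \<Longrightarrow> weight N \<omega> \<alpha> < d"
  shows "wlead_form N \<omega> (p + q) = p"
proof -
  obtain \<alpha> where \<alpha>: "\<alpha> \<in> Poly_Mapping.keys p" using \<open>p \<noteq> 0\<close> by (metis ex_in_conv keys_eq_empty)
  then have "\<alpha> \<notin> Poly_Mapping.keys q" using p q by force
  then have "\<alpha> \<in> Poly_Mapping.keys (p + q)" using \<alpha> by (simp add: in_keys_iff lookup_add)
  then have "wdeg N \<omega> (p + q) = d"
    unfolding wdeg_def using p[OF \<alpha>] p q Poly_Mapping.keys_add[of p q]
    by (intro Max_eqI) (force simp: less_imp_le)+
  then show ?thesis
    using p q by (intro poly_mapping_eqI) (force simp: lookup_wlead_form lookup_add in_keys_iff)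
qed

text \<open>
  Split each factor into its leading form and the terms of smaller weight. In the product only
  the two leading forms reach the sum of the degrees, and they do not cancel because the
  polynomial ring is a domain.
\<close>

lemma wlead_form_mult:
  fixes f g :: "'a::field mpoly"
  assumes "f \<noteq> 0" "g \<noteq> 0"
  shows "wlead_form N \<omega> (f * g) = wlead_form N \<omega> f * wlead_form N \<omega> g"
proof -
  define p where "p = wlead_form N \<omega> f"
  define q where "q = wlead_form N \<omega> g"
  define d where "d = wdeg N \<omega> f + wdeg N \<omega> g"
  have lower: "weight N \<omega> \<alpha> < wdeg N \<omega> h" if "\<alpha> \<in> Poly_Mapping.keys (h - wlead_form N \<omega> h)"
    for \<alpha> and h :: "'a mpoly"
  proof -
    have "\<alpha> \<in> Poly_Mapping.keys h" "weight N \<omega> \<alpha> \<noteq> wdeg N \<omega> h"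
      using that by (auto simp: in_keys_iff lookup_minus lookup_wlead_form split: if_splits)
    then show ?thesis using weight_le_wdeg[of \<alpha> h N \<omega>] by simp
  qed
  have "f * g = p * q + (p * (g - q) + (f - p) * g)" by (simp add: algebra_simps)
  moreover have "wlead_form N \<omega> (p * q + (p * (g - q) + (f - p) * g)) = p * q"
  proof (rule wlead_form_add_lower[where d = d])
    show "p * q \<noteq> 0" using assms wlead_form_nonzero by (auto simp: p_def q_def)
    show "weight N \<omega> \<alpha> = d" if "\<alpha> \<in> Poly_Mapping.keys (p * q)" for \<alpha>
      using that Poly_Mapping.keys_mult[of p q]
      by (auto simp: p_def q_def keys_wlead_form weight_add d_def)
    show "weight N \<omega> \<alpha> < d" if \<alpha>: "\<alpha> \<in> Poly_Mapping.keys (p * (g - q) + (f - p) * g)" for \<alpha>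
    proof -
      consider \<beta> \<gamma> where "\<alpha> = \<beta> + \<gamma>" "\<beta> \<in> Poly_Mapping.keys p" "\<gamma> \<in> Poly_Mapping.keys (g - q)"
        | \<beta> \<gamma> where "\<alpha> = \<beta> + \<gamma>" "\<beta> \<in> Poly_Mapping.keys (f - p)" "\<gamma> \<in> Poly_Mapping.keys g"
        using \<alpha> Poly_Mapping.keys_add[of "p * (g - q)" "(f - p) * g"]
          Poly_Mapping.keys_mult[of p "g - q"] Poly_Mapping.keys_mult[of "f - p" g] by blast
      then show ?thesis
      proof cases
        case 1
        then have "weight N \<omega> \<beta> = wdeg N \<omega> f" "weight N \<omega> \<gamma> < wdeg N \<omega> g"
          using lower by (auto simp: p_def q_def keys_wlead_form)
        then show ?thesis by (simp add: 1 weight_add d_def)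
      next
        case 2
        then have "weight N \<omega> \<beta> < wdeg N \<omega> f" "weight N \<omega> \<gamma> \<le> wdeg N \<omega> g"
          using lower weight_le_wdeg by (auto simp: p_def)
        then show ?thesis by (simp add: 2 weight_add d_def)
      qed
    qed
  qed
  ultimately show ?thesis by (simp add: p_def q_def)
qed

lemma wlead_form_eq_single:
  assumes "\<gamma> \<in> Poly_Mapping.keys f"
    and "\<And>\<alpha>. \<alpha> \<in> Poly_Mapping.keys f \<Longrightarrow> \<alpha> \<noteq> \<gamma> \<Longrightarrow> weight N \<omega> \<alpha> < weight N \<omega> \<gamma>"
  shows "wlead_form N \<omega> f = Poly_Mapping.single \<gamma> (Poly_Mapping.lookup f \<gamma>)"
proof -
  have "wdeg N \<omega> f = weight N \<omega> \<gamma>"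
    unfolding wdeg_def using assms by (intro Max_eqI) (force simp: less_imp_le)+
  then show ?thesis
    using assms by (intro poly_mapping_eqI)
      (force simp: lookup_wlead_form lookup_single when_def in_keys_iff)
qed

text \<open>
  The leading form of a multiple \<open>g f\<close> is a multiple of the leading form of \<open>f\<close>, by
  multiplicativity.
\<close>

lemma wlead_ideal_PIdl:
  fixes f :: "'a::field mpoly"
  assumes "f \<noteq> 0" and f: "f \<in> carrier (mpoly_ring N)"
  shows "wlead_ideal N \<omega> (PIdl\<^bsub>mpoly_ring N\<^esub> f) = PIdl\<^bsub>mpoly_ring N\<^esub> (wlead_form N \<omega> f)"
proof -
  interpret cring "mpoly_ring N :: 'a mpoly ring" by (rule mpoly_ring_cring)
  let ?P = "PIdl\<^bsub>mpoly_ring N\<^esub> (wlead_form N \<omega> f)"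
  let ?L = "wlead_form N \<omega> ` (PIdl\<^bsub>mpoly_ring N\<^esub> f - {0})"
  have sub: "?L \<subseteq> ?P"
    unfolding PIdl_mpoly_ring
  proof (rule image_subsetI)
    fix h assume "h \<in> (\<lambda>g. g * f) ` carrier (mpoly_ring N) - {0}"
    then obtain g where g: "g \<in> carrier (mpoly_ring N)" "g \<noteq> 0" "h = g * f" by auto
    then show "wlead_form N \<omega> h \<in> (\<lambda>g. g * wlead_form N \<omega> f) ` carrier (mpoly_ring N)"
      by (auto simp: wlead_form_mult[OF _ \<open>f \<noteq> 0\<close>] intro!: imageI wlead_form_carrier)
  qed
  have id: "ideal ?P (mpoly_ring N)" by (intro cgenideal_ideal wlead_form_carrier f)
  then have car: "?P \<subseteq> carrier (mpoly_ring N)"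
    by (meson ideal.axioms(1) additive_subgroup.a_subset)
  have "wlead_form N \<omega> f \<in> ?L" using cgenideal_self[OF f] \<open>f \<noteq> 0\<close> by auto
  then have "wlead_form N \<omega> f \<in> Idl\<^bsub>mpoly_ring N\<^esub> ?L"
    using genideal_self[of ?L] sub car by blast
  then have "?P \<subseteq> Idl\<^bsub>mpoly_ring N\<^esub> ?L"
    using sub car by (intro cgenideal_minimal genideal_ideal) auto
  then show ?thesis
    unfolding wlead_ideal_def using genideal_minimal[OF id sub] by blast
qed

section \<open>Monomial orders given by generic weights\<close>

definition weight_order :: "nat \<Rightarrow> (nat \<Rightarrow> real) \<Rightarrow> expo rel" where
  "weight_order N \<omega> = {(\<alpha>, \<beta>) \<in> expos N \<times> expos N. weight N \<omega> \<alpha> \<le> weight N \<omega> \<beta>}"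

text \<open>
  Genericity is separation of exponents, which makes the comparison of weights antisymmetric;
  positivity makes it well-founded.
\<close>

definition generic_weight :: "nat \<Rightarrow> (nat \<Rightarrow> real) \<Rightarrow> bool" where
  "generic_weight N \<omega> \<longleftrightarrow> (\<forall>i<N. 0 < \<omega> i) \<and> inj_on (weight N \<omega>) (expos N)"

text \<open>
  A positive weight bounds each exponent by \<open>c / \<omega>\<^sub>i\<close>, so every initial segment of the order is
  finite. This replaces Dickson's lemma in the proof of well-foundedness.
\<close>

lemma finite_weight_le:
  assumes pos: "\<And>i. i < N \<Longrightarrow> 0 < \<omega> i"
  shows "finite {\<alpha> \<in> expos N. weight N \<omega> \<alpha> \<le> c}"
proof -
  (* The sum of the bounds for the single coordinates is a bound for all of them. *)
  define B where "B = nat \<lceil>\<Sum>i<N. \<bar>c\<bar> / \<omega> i\<rceil>"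
  have bound: "Poly_Mapping.lookup \<alpha> i \<le> B" if "i < N" "weight N \<omega> \<alpha> \<le> c" for \<alpha> i
  proof -
    have "\<omega> i * real (Poly_Mapping.lookup \<alpha> i) \<le> weight N \<omega> \<alpha>"
      using that(1) pos by (intro weight_ge_summand) (auto simp: less_imp_le)
    then have "real (Poly_Mapping.lookup \<alpha> i) \<le> \<bar>c\<bar> / \<omega> i"
      using pos[OF that(1)] that(2) by (simp add: field_simps)
    also have "\<dots> \<le> (\<Sum>i<N. \<bar>c\<bar> / \<omega> i)"
      using that(1) pos by (intro member_le_sum) (auto simp: less_imp_le)
    finally show ?thesis unfolding B_def by linarith
  qed
  have "{\<alpha> \<in> expos N. weight N \<omega> \<alpha> \<le> c} \<subseteq>
      Poly_Mapping.lookup -` {h. \<forall>i. (i \<in> {..<N} \<longrightarrow> h i \<in> {..B}) \<and> (i \<notin> {..<N} \<longrightarrow> h i = 0)}"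
    using bound by (force simp: expos_def in_keys_iff)
  moreover have "finite \<dots>"
    using finite_set_of_finite_funs[of "{..<N}" "{..B}" "0::nat"]
    by (intro finite_vimageI) (auto simp: inj_on_def)
  ultimately show ?thesis by (rule finite_subset)
qed

lemma monomial_order_weight_order:
  assumes "generic_weight N \<omega>"
  shows "monomial_order N (weight_order N \<omega>)"
proof -
  have pos: "\<And>i. i < N \<Longrightarrow> 0 < \<omega> i" and inj: "inj_on (weight N \<omega>) (expos N)"
    using assms by (auto simp: generic_weight_def)
  have "linear_order_on (expos N) (weight_order N \<omega>)"
    using inj by (auto simp: weight_order_def order_on_defs refl_on_def trans_def antisym_def
        total_on_def inj_on_def)
  moreover have "wf (weight_order N \<omega> - Id)"
  proof (rule wfI_min)
    fix \<alpha> and Q :: "expo set" assume "\<alpha> \<in> Q"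
    show "\<exists>z\<in>Q. \<forall>y. (y, z) \<in> weight_order N \<omega> - Id \<longrightarrow> y \<notin> Q"
    proof (cases "\<alpha> \<in> expos N")
      case False
      then show ?thesis using \<open>\<alpha> \<in> Q\<close> by (force simp: weight_order_def)
    next
      case True
      define S where "S = Q \<inter> {\<beta> \<in> expos N. weight N \<omega> \<beta> \<le> weight N \<omega> \<alpha>}"
      have "finite S" "S \<noteq> {}"
        using finite_weight_le[OF pos] True \<open>\<alpha> \<in> Q\<close> by (auto simp: S_def)
      then obtain z where z: "z \<in> S" "\<And>y. y \<in> S \<Longrightarrow> weight N \<omega> z \<le> weight N \<omega> y"
        by (metis arg_min_if_finite not_le)
      have "y \<notin> Q" if "(y, z) \<in> weight_order N \<omega> - Id" for y
      proof
        assume "y \<in> Q"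
        have y: "y \<in> expos N" "weight N \<omega> y \<le> weight N \<omega> z" "y \<noteq> z"
          using that by (auto simp: weight_order_def)
        then have "y \<in> S" using \<open>y \<in> Q\<close> z(1) by (auto simp: S_def)
        then show False using z y inj by (force simp: S_def inj_on_def)
      qed
      then show ?thesis using z(1) by (auto simp: S_def)
    qed
  qed
  ultimately show ?thesis
    unfolding monomial_order_def well_order_on_def
    by (auto simp: weight_order_def weight_add intro: expos_add)
qed

text \<open>
  A generic weight attains its maximum over the exponents of \<open>f\<close> only once. The leading form is
  therefore a single term, the one that the order selects.
\<close>

lemma lead_weight_order:
  fixes f :: "'a::field mpoly"
  assumes gen: "generic_weight N \<omega>" and "f \<noteq> 0" and f: "f \<in> carrier (mpoly_ring N)"
  shows lead_expo_in_keys: "lead_expo (weight_order N \<omega>) f \<in> Poly_Mapping.keys f"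
    and weight_lead_expo: "weight N \<omega> (lead_expo (weight_order N \<omega>) f) = wdeg N \<omega> f"
    and lead_term_eq_wlead_form: "lead_term (weight_order N \<omega>) f = wlead_form N \<omega> f"
proof -
  obtain \<gamma> where \<gamma>: "\<gamma> \<in> Poly_Mapping.keys f" "weight N \<omega> \<gamma> = wdeg N \<omega> f"
    using wdeg_attained[OF \<open>f \<noteq> 0\<close>] .
  have inj: "inj_on (weight N \<omega>) (expos N)" and keys: "Poly_Mapping.keys f \<subseteq> expos N"
    using gen f by (auto simp: generic_weight_def mem_carrier)
  have max: "weight N \<omega> \<alpha> < weight N \<omega> \<gamma>" if "\<alpha> \<in> Poly_Mapping.keys f" "\<alpha> \<noteq> \<gamma>" for \<alpha>
  proof -
    have "weight N \<omega> \<alpha> \<noteq> weight N \<omega> \<gamma>" using inj_onD[OF inj, of \<alpha> \<gamma>] that \<gamma>(1) keys by blast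
    then show ?thesis using weight_le_wdeg[OF that(1), of N \<omega>] \<gamma>(2) by simp
  qed
  have lead: "lead_expo (weight_order N \<omega>) f = \<gamma>"
    unfolding lead_expo_def
  proof (rule the_equality)
    show "\<gamma> \<in> Poly_Mapping.keys f \<and>
        (\<forall>\<beta>\<in>Poly_Mapping.keys f. (\<beta>, \<gamma>) \<in> weight_order N \<omega>)"
      using \<gamma> keys weight_le_wdeg[of _ f N \<omega>] by (auto simp: weight_order_def)
    fix \<alpha> assume \<alpha>: "\<alpha> \<in> Poly_Mapping.keys f \<and>
        (\<forall>\<beta>\<in>Poly_Mapping.keys f. (\<beta>, \<alpha>) \<in> weight_order N \<omega>)"
    then have "weight N \<omega> \<gamma> \<le> weight N \<omega> \<alpha>" using \<gamma>(1) by (auto simp: weight_order_def)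
    then show "\<alpha> = \<gamma>" using \<alpha> max[of \<alpha>] by force
  qed
  show "lead_expo (weight_order N \<omega>) f \<in> Poly_Mapping.keys f"
    "weight N \<omega> (lead_expo (weight_order N \<omega>) f) = wdeg N \<omega> f"
    using lead \<gamma> by simp_all
  show "lead_term (weight_order N \<omega>) f = wlead_form N \<omega> f"
    unfolding lead_term_def lead_coef_def lead using wlead_form_eq_single[OF \<gamma>(1) max] by simp
qed

lemma lead_ideal_weight_order:
  fixes I :: "'a::field mpoly set"
  assumes "generic_weight N \<omega>" "I \<subseteq> carrier (mpoly_ring N)"
  shows "lead_ideal N (weight_order N \<omega>) I = wlead_ideal N \<omega> I"
proof -
  have "lead_term (weight_order N \<omega>) ` (I - {0}) = wlead_form N \<omega> ` (I - {0})"
    using lead_term_eq_wlead_form[OF assms(1)] assms(2) by (intro image_cong) auto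
  then show ?thesis by (simp add: lead_ideal_def wlead_ideal_def)
qed

section \<open>The reduced basis of a principal ideal\<close>

text \<open>
  A lower bound on the weight of all terms survives sums, and it survives multiplication by
  arbitrary polynomials because weights are nonnegative. So generators whose terms are all
  heavier than a monomial cannot generate it.
\<close>

lemma ideal_weight_greater:
  assumes nonneg: "\<And>i. i < N \<Longrightarrow> 0 \<le> \<omega> i"
  shows "ideal {p :: 'a::field mpoly. p \<in> carrier (mpoly_ring N) \<and>
    (\<forall>\<alpha>\<in>Poly_Mapping.keys p. c < weight N \<omega> \<alpha>)} (mpoly_ring N)" (is "ideal ?J _")
proof -
  interpret cring "mpoly_ring N :: 'a mpoly ring" by (rule mpoly_ring_cring)
  have weight_nonneg: "0 \<le> weight N \<omega> \<alpha>" for \<alpha>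
    unfolding weight_def using nonneg by (intro sum_nonneg) auto
  have mult: "p * q \<in> ?J" if "p \<in> ?J" "q \<in> carrier (mpoly_ring N)" for p q :: "'a mpoly"
  proof -
    have "p * q \<in> carrier (mpoly_ring N)"
      using m_closed[of p q] that by (simp add: mpoly_ring_def)
    moreover have "c < weight N \<omega> \<alpha>" if \<alpha>: "\<alpha> \<in> Poly_Mapping.keys (p * q)" for \<alpha>
    proof -
      obtain \<beta> \<gamma> where "\<alpha> = \<beta> + \<gamma>" "\<beta> \<in> Poly_Mapping.keys p"
        using \<alpha> Poly_Mapping.keys_mult[of p q] by blast
      then show ?thesis
        using \<open>p \<in> ?J\<close> weight_nonneg[of \<gamma>] by (force simp: weight_add)
    qed
    ultimately show ?thesis by simp
  qed
  show ?thesis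
  proof (rule idealI)
    show "ring (mpoly_ring N :: 'a mpoly ring)" by (rule ring_axioms)
    show "subgroup ?J (add_monoid (mpoly_ring N))"
    proof (rule add.subgroupI)
      show "?J \<noteq> {}" using zero_closed by (auto simp: mpoly_ring_def intro!: exI[of _ 0])
      fix p q assume pq: "p \<in> ?J" "q \<in> ?J"
      then show "p \<oplus>\<^bsub>mpoly_ring N\<^esub> q \<in> ?J"
        using a_closed[of p q] Poly_Mapping.keys_add[of p q] by (auto simp: mpoly_ring_def)
      have "p \<oplus>\<^bsub>mpoly_ring N\<^esub> - p = \<zero>\<^bsub>mpoly_ring N\<^esub>" by (simp add: mpoly_ring_def)
      then have "\<ominus>\<^bsub>mpoly_ring N\<^esub> p = - p"
        using pq(1) by (intro minus_equality) (auto simp: mpoly_ring_def)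
      then show "\<ominus>\<^bsub>mpoly_ring N\<^esub> p \<in> ?J" using pq(1) by (simp add: mem_carrier)
    qed auto
    fix p q :: "'a mpoly" assume pq: "p \<in> ?J" "q \<in> carrier (mpoly_ring N)"
    show "p \<otimes>\<^bsub>mpoly_ring N\<^esub> q \<in> ?J" using mult[OF pq] by (simp add: mpoly_ring_def)
    show "q \<otimes>\<^bsub>mpoly_ring N\<^esub> p \<in> ?J"
      using mult[OF pq] by (simp add: mpoly_ring_def mult.commute)
  qed
qed

lemma expo_eq_zero:
  assumes "\<And>i. i < N \<Longrightarrow> 0 < \<omega> i" "\<alpha> \<in> expos N" "weight N \<omega> \<alpha> \<le> 0"
  shows "\<alpha> = 0"
proof (rule poly_mapping_eqI)
  fix i
  show "Poly_Mapping.lookup \<alpha> i = Poly_Mapping.lookup 0 i"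
  proof (cases "i < N")
    case True
    have "\<omega> i * real (Poly_Mapping.lookup \<alpha> i) \<le> weight N \<omega> \<alpha>"
      using True assms(1) by (intro weight_ge_summand) (auto simp: less_imp_le)
    then have "\<omega> i * real (Poly_Mapping.lookup \<alpha> i) \<le> 0" using assms(3) by linarith
    then show ?thesis using assms(1)[OF True] by (simp add: mult_le_0_iff)
  qed (use assms(2) in \<open>auto simp: expos_def in_keys_iff\<close>)
qed

text \<open>
  The defining description of the reduced basis selects one set, so both existence and uniqueness
  matter. That \<open>{f}\<close> qualifies is immediate from \<open>\<langle>lt(I)\<rangle> = \<langle>lt(f)\<rangle>\<close>. For uniqueness, let \<open>G\<close>
  be another such basis. Its elements are multiples \<open>h f\<close>. If all of them had leading terms
  heavier than \<open>lt(f)\<close>, then these could not generate \<open>lt(f)\<close>; so for some element \<open>h\<close> is a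
  constant, which is \<open>1\<close> by normalization. Hence \<open>f \<in> G\<close>, and its leading term divides those of
  all other elements, so reducedness leaves no room for them.
\<close>

lemma GB_PIdl:
  fixes f :: "'a::field mpoly"
  assumes gen: "generic_weight N \<omega>" and f: "f \<in> carrier (mpoly_ring N)"
    and monic: "lead_coef (weight_order N \<omega>) f = 1"
  shows "GB N (weight_order N \<omega>) (PIdl\<^bsub>mpoly_ring N\<^esub> f) = {f}"
proof -
  interpret cring "mpoly_ring N :: 'a mpoly ring" by (rule mpoly_ring_cring)
  let ?r = "weight_order N \<omega>" and ?I = "PIdl\<^bsub>mpoly_ring N\<^esub> f"
  have pos: "\<And>i. i < N \<Longrightarrow> 0 < \<omega> i" using gen by (simp add: generic_weight_def)
  have "f \<noteq> 0" using monic by (auto simp: lead_coef_def)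
  define \<gamma> where "\<gamma> = lead_expo ?r f"
  have I: "ideal ?I (mpoly_ring N)" "?I \<subseteq> carrier (mpoly_ring N)"
    using cgenideal_ideal[OF f] by (auto dest: ideal.axioms(1) additive_subgroup.a_subset)
  have lt_f: "lead_term ?r f = Poly_Mapping.single \<gamma> 1" by (simp add: lead_term_def monic \<gamma>_def)
  have lt_f_carrier: "lead_term ?r f \<in> carrier (mpoly_ring N)"
    using lead_term_eq_wlead_form[OF gen \<open>f \<noteq> 0\<close> f] wlead_form_carrier[OF f] by simp
  have lead_I: "lead_ideal N ?r ?I = PIdl\<^bsub>mpoly_ring N\<^esub> (lead_term ?r f)"
    by (simp add: lead_ideal_weight_order[OF gen I(2)] wlead_ideal_PIdl[OF \<open>f \<noteq> 0\<close> f]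
        lead_term_eq_wlead_form[OF gen \<open>f \<noteq> 0\<close> f])
  have lt_mult: "lead_term ?r (h * f) = lead_term ?r h * lead_term ?r f"
    "lead_expo ?r (h * f) = lead_expo ?r h + \<gamma>"
    "lead_coef ?r (h * f) = lead_coef ?r h"
    if "h \<in> carrier (mpoly_ring N)" "h \<noteq> 0" for h
  proof -
    have hf: "h * f \<noteq> 0" "h * f \<in> carrier (mpoly_ring N)"
      using that \<open>f \<noteq> 0\<close> m_closed[OF that(1) f] by (auto simp: mpoly_ring_def)
    show eq: "lead_term ?r (h * f) = lead_term ?r h * lead_term ?r f"
      using that hf f \<open>f \<noteq> 0\<close> by (simp add: lead_term_eq_wlead_form[OF gen] wlead_form_mult)
    have "lead_coef ?r (h * f) \<noteq> 0"
      using lead_expo_in_keys[OF gen hf] by (simp add: lead_coef_def in_keys_iff)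
    moreover have "Poly_Mapping.single (lead_expo ?r (h * f)) (lead_coef ?r (h * f)) =
        Poly_Mapping.single (lead_expo ?r h + \<gamma>) (lead_coef ?r h)"
      using eq unfolding lt_f by (simp add: lead_term_def mult_single)
    ultimately show "lead_expo ?r (h * f) = lead_expo ?r h + \<gamma>"
      "lead_coef ?r (h * f) = lead_coef ?r h"
      by (metis lookup_single_eq lookup_single_not_eq)+
  qed
  have "groebner_basis N ?r ?I {f}"
    unfolding groebner_basis_def lead_I using cgenideal_self[OF f] \<open>f \<noteq> 0\<close>
    by (simp add: cgenideal_eq_genideal[OF lt_f_carrier])
  moreover have "reduced N ?r {f}" "normed ?r {f}" by (auto simp: reduced_def normed_def monic)
  moreover have "G = {f}"
    if G: "groebner_basis N ?r ?I G" "reduced N ?r G" "normed ?r G" for G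
  proof -
    have "0 \<notin> G" using G(3) by (auto simp: normed_def lead_coef_def)
    have G_sub: "G \<subseteq> ?I"
      and G_gen: "Idl\<^bsub>mpoly_ring N\<^esub> (lead_term ?r ` (G - {0})) = PIdl\<^bsub>mpoly_ring N\<^esub> (lead_term ?r f)"
      using G(1) by (simp_all only: groebner_basis_def lead_I)
    have nonzero: "g \<noteq> 0" and carrier: "g \<in> carrier (mpoly_ring N)" if "g \<in> G" for g
      using that \<open>0 \<notin> G\<close> G_sub I(2) by blast+
    have factor: "\<exists>h. h \<in> carrier (mpoly_ring N) \<and> h \<noteq> 0 \<and> g = h * f" if "g \<in> G" for g
    proof -
      obtain h where "h \<in> carrier (mpoly_ring N)" "g = h * f"
        using \<open>g \<in> G\<close> G_sub unfolding PIdl_mpoly_ring by blast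
      then show ?thesis using nonzero[OF \<open>g \<in> G\<close>] by auto
    qed
    have "\<exists>g\<in>G. weight N \<omega> (lead_expo ?r g) \<le> weight N \<omega> \<gamma>"
    proof (rule ccontr)
      assume *: "\<not> ?thesis"
      (* Then all leading terms of G lie in an ideal that does not contain the one of f. *)
      let ?J = "{p :: 'a mpoly. p \<in> carrier (mpoly_ring N) \<and>
        (\<forall>\<alpha>\<in>Poly_Mapping.keys p. weight N \<omega> \<gamma> < weight N \<omega> \<alpha>)}"
      have "lead_term ?r g \<in> ?J" if "g \<in> G" for g
      proof -
        have "lead_term ?r g \<in> carrier (mpoly_ring N)"
          using nonzero carrier that
          by (simp add: lead_term_eq_wlead_form[OF gen] wlead_form_carrier)
        then show ?thesis using * that by (auto simp: lead_term_def split: if_splits)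
      qed
      then have "Idl\<^bsub>mpoly_ring N\<^esub> (lead_term ?r ` (G - {0})) \<subseteq> ?J"
        by (intro genideal_minimal ideal_weight_greater) (auto simp: less_imp_le pos)
      moreover have "lead_term ?r f \<in> Idl\<^bsub>mpoly_ring N\<^esub> (lead_term ?r ` (G - {0}))"
        unfolding G_gen by (rule cgenideal_self[OF lt_f_carrier])
      ultimately show False by (auto simp: lt_f)
    qed
    then obtain g where g: "g \<in> G" "weight N \<omega> (lead_expo ?r g) \<le> weight N \<omega> \<gamma>" by blast
    obtain h where h: "h \<in> carrier (mpoly_ring N)" "h \<noteq> 0" "g = h * f" using factor[OF g(1)] by blast
    (* The cofactor h has degree 0 in a positive weight, so it is a constant. *)
    have "wdeg N \<omega> h \<le> 0"
      using g(2) lt_mult(2)[OF h(1,2)] weight_lead_expo[OF gen h(2,1)] by (simp add: h(3) weight_add)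
    then have "\<alpha> = 0" if "\<alpha> \<in> Poly_Mapping.keys h" for \<alpha>
      using that weight_le_wdeg[OF that, of N \<omega>] h(1)
      by (intro expo_eq_zero[OF pos]) (auto simp: mem_carrier)
    moreover have "lead_expo ?r h = 0"
      using calculation lead_expo_in_keys[OF gen h(2,1)] by simp
    moreover have "lead_coef ?r h = 1"
      using lt_mult(3)[OF h(1,2)] G(3) g(1) by (simp add: h(3) normed_def)
    ultimately have "h = 1"
      by (intro poly_mapping_eqI) (auto simp: lead_coef_def lookup_one when_def in_keys_iff)
    then have "f \<in> G" using g(1) h(3) by simp
    moreover have "g' = f" if g': "g' \<in> G" for g'
    proof (rule ccontr)
      assume "g' \<noteq> f"
      obtain h' where h': "h' \<in> carrier (mpoly_ring N)" "h' \<noteq> 0" "g' = h' * f"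
        using factor[OF g'] by blast
      have "Poly_Mapping.single (lead_expo ?r h') (1::'a) \<in> carrier (mpoly_ring N)"
        using lead_expo_in_keys[OF gen h'(2,1)] h'(1) by (auto simp: mem_carrier)
      then have "lead_term ?r f divides\<^bsub>mpoly_ring N\<^esub> (Poly_Mapping.single (lead_expo ?r g') 1)"
        unfolding factor_def lt_f h'(3) lt_mult(2)[OF h'(1,2)]
        by (intro bexI[of _ "Poly_Mapping.single (lead_expo ?r h') 1"])
          (auto simp: mpoly_ring_def mult_single add.commute)
      moreover have "lead_expo ?r g' \<in> Poly_Mapping.keys g'"
        by (rule lead_expo_in_keys[OF gen nonzero[OF g'] carrier[OF g']])
      ultimately show False
        using G(2)[unfolded reduced_def, rule_format, OF \<open>f \<in> G\<close> g'] \<open>g' \<noteq> f\<close> by metis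
    qed
    ultimately show ?thesis by blast
  qed
  ultimately show ?thesis unfolding GB_def by (intro the_equality) blast+
qed

section \<open>The cones of a principal ideal\<close>

text \<open>
  Both ideals are principal, generated by the leading form of \<open>f\<close> and by \<open>y\<^sup>\<gamma>\<close>. If they agree,
  all terms of the leading form are divisible by \<open>y\<^sup>\<gamma>\<close>. As \<open>y\<^sup>\<gamma>\<close> divides no
  other monomial of \<open>f\<close>, it is the only term, so that the inequalities are strict.
\<close>

lemma open_cone_PIdl:
  fixes f :: "'a::field mpoly"
  assumes gen: "generic_weight N \<omega>" and f: "f \<in> carrier (mpoly_ring N)"
    and \<gamma>: "\<gamma> \<in> Poly_Mapping.keys f" "Poly_Mapping.lookup f \<gamma> = 1"
    and lead: "\<And>\<alpha>. \<alpha> \<in> Poly_Mapping.keys f \<Longrightarrow> \<alpha> \<noteq> \<gamma> \<Longrightarrow> weight N \<omega> \<alpha> < weight N \<omega> \<gamma>"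
    and nodiv: "\<And>\<alpha> \<beta>. \<alpha> \<in> Poly_Mapping.keys f \<Longrightarrow> \<alpha> \<noteq> \<gamma> \<Longrightarrow> \<alpha> \<noteq> \<beta> + \<gamma>"
  shows "{\<omega>' \<in> weights N. wlead_ideal N \<omega>' (PIdl\<^bsub>mpoly_ring N\<^esub> f) =
      lead_ideal N (weight_order N \<omega>) (PIdl\<^bsub>mpoly_ring N\<^esub> f)} =
    {\<omega>' \<in> weights N. \<forall>\<alpha>\<in>Poly_Mapping.keys f - {\<gamma>}. weight N \<omega>' \<alpha> < weight N \<omega>' \<gamma>}"
proof -
  interpret cring "mpoly_ring N :: 'a mpoly ring" by (rule mpoly_ring_cring)
  have "f \<noteq> 0" using \<gamma> by auto
  let ?P = "PIdl\<^bsub>mpoly_ring N\<^esub> (Poly_Mapping.single \<gamma> (1::'a))"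
  have "PIdl\<^bsub>mpoly_ring N\<^esub> f \<subseteq> carrier (mpoly_ring N)"
    using cgenideal_ideal[OF f] by (auto dest: ideal.axioms(1) additive_subgroup.a_subset)
  then have lead_I: "lead_ideal N (weight_order N \<omega>) (PIdl\<^bsub>mpoly_ring N\<^esub> f) = ?P"
    using wlead_form_eq_single[OF \<gamma>(1) lead]
    by (simp add: lead_ideal_weight_order[OF gen] wlead_ideal_PIdl[OF \<open>f \<noteq> 0\<close> f] \<gamma>(2))
  have "PIdl\<^bsub>mpoly_ring N\<^esub> (wlead_form N \<omega>' f) = ?P \<longleftrightarrow>
    (\<forall>\<alpha>\<in>Poly_Mapping.keys f - {\<gamma>}. weight N \<omega>' \<alpha> < weight N \<omega>' \<gamma>)" for \<omega>'
  proof
    assume "PIdl\<^bsub>mpoly_ring N\<^esub> (wlead_form N \<omega>' f) = ?P"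
    then have "wlead_form N \<omega>' f \<in> ?P" using cgenideal_self[OF wlead_form_carrier[OF f]] by blast
    then obtain g where g: "wlead_form N \<omega>' f = g * Poly_Mapping.single \<gamma> 1"
      by (auto simp: PIdl_mpoly_ring)
    have top: "\<alpha> = \<gamma>" if "\<alpha> \<in> Poly_Mapping.keys f" "weight N \<omega>' \<alpha> = wdeg N \<omega>' f" for \<alpha>
    proof -
      have "\<alpha> \<in> Poly_Mapping.keys (g * Poly_Mapping.single \<gamma> 1)"
        using that keys_wlead_form[of N \<omega>' f] by (simp add: g)
      then obtain \<beta> where "\<alpha> = \<beta> + \<gamma>"
        using Poly_Mapping.keys_mult[of g "Poly_Mapping.single \<gamma> 1"] by auto
      then show ?thesis using nodiv[OF that(1)] by blast
    qed
    obtain \<delta> where "\<delta> \<in> Poly_Mapping.keys f" "weight N \<omega>' \<delta> = wdeg N \<omega>' f"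
      using wdeg_attained[OF \<open>f \<noteq> 0\<close>] .
    then have "weight N \<omega>' \<gamma> = wdeg N \<omega>' f" using top by blast
    then show "\<forall>\<alpha>\<in>Poly_Mapping.keys f - {\<gamma>}. weight N \<omega>' \<alpha> < weight N \<omega>' \<gamma>"
      using weight_le_wdeg[of _ f N \<omega>'] top by force
  next
    assume "\<forall>\<alpha>\<in>Poly_Mapping.keys f - {\<gamma>}. weight N \<omega>' \<alpha> < weight N \<omega>' \<gamma>"
    then show "PIdl\<^bsub>mpoly_ring N\<^esub> (wlead_form N \<omega>' f) = ?P"
      using wlead_form_eq_single[OF \<gamma>(1), of N \<omega>'] \<gamma>(2) by simp
  qed
  then show ?thesis by (simp add: lead_I wlead_ideal_PIdl[OF \<open>f \<noteq> 0\<close> f])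
qed

section \<open>The orthant in Euclidean space\<close>

text \<open>
  Moving along the ray from \<open>\<omega>\<close> in direction \<open>v\<close> is a continuous curve. Every limit point needed
  below, on a common face of two cones or on the boundary of the orthant, is reached in this way.
\<close>

lemma Euclidean_space_closure_ray:
  assumes \<omega>: "\<omega> \<in> topspace (Euclidean_space N)" and v: "v \<in> topspace (Euclidean_space N)"
    and A: "\<And>t. 0 < t \<Longrightarrow> (\<lambda>i. \<omega> i + t * v i) \<in> A"
  shows "\<omega> \<in> Euclidean_space N closure_of A"
proof -
  have "continuous_map euclideanreal (Euclidean_space N)
      (\<lambda>t i. if i < N then \<omega> i + t * v i else 0)"
    unfolding continuous_map_componentwise_Euclidean_space by (auto intro!: continuous_intros)
  moreover have eq: "(if i < N then \<omega> i + t * v i else 0) = \<omega> i + t * v i" for t i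
    using \<omega> v by (auto simp: topspace_Euclidean_space)
  ultimately have cont: "continuous_map euclideanreal (Euclidean_space N) (\<lambda>t i. \<omega> i + t * v i)"
    by (simp only: eq)
  have "(0::real) \<in> euclideanreal closure_of {0<..}" by simp
  then have "(\<lambda>i. \<omega> i + 0 * v i) \<in>
      Euclidean_space N closure_of ((\<lambda>t i. \<omega> i + t * v i) ` {0<..})"
    using continuous_map_image_closure_subset[OF cont, of "{0<..}"] by blast
  also have "\<dots> \<subseteq> Euclidean_space N closure_of A"
    using A by (intro closure_of_mono) auto
  finally show ?thesis by simp
qed

lemma continuous_map_Euclidean_coordinate:
  "continuous_map (Euclidean_space N) euclideanreal (\<lambda>\<omega>. \<omega> i)"
  unfolding Euclidean_space_def
  by (intro continuous_map_from_subtopology continuous_map_product_projection) simp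

lemma closedin_halfplane:
  "closedin (Euclidean_space N) {\<omega> \<in> topspace (Euclidean_space N). c * \<omega> i - \<omega> j \<in> {0..}}"
proof (rule closedin_continuous_map_preimage)
  show "continuous_map (Euclidean_space N) euclideanreal (\<lambda>\<omega>. c * \<omega> i - \<omega> j)"
    by (rule continuous_map_diff[OF continuous_map_real_mult_left[OF
            continuous_map_Euclidean_coordinate] continuous_map_Euclidean_coordinate])
qed simp

lemma closedin_weights: "closedin (Euclidean_space N) (weights N)"
proof -
  have "weights N = topspace (Euclidean_space N) \<inter>
      (\<Inter>i\<in>{..<N}. {\<omega> \<in> topspace (Euclidean_space N). \<omega> i \<in> {0..}})"
    by (auto simp: weights_def)
  moreover have "closedin (Euclidean_space N) {\<omega> \<in> topspace (Euclidean_space N). \<omega> i \<in> {0..}}" for i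
    by (intro closedin_continuous_map_preimage[OF continuous_map_Euclidean_coordinate]) simp
  then have "closedin (Euclidean_space N) (topspace (Euclidean_space N) \<inter>
      (\<Inter>i\<in>{..<N}. {\<omega> \<in> topspace (Euclidean_space N). \<omega> i \<in> {0..}}))"
    by (cases "N = 0") (force intro!: closedin_Int closedin_Inter)+
  ultimately show ?thesis by simp
qed

text \<open>
  A point with positive coordinates has a neighbourhood of such points. At a point with
  \<open>\<omega>\<^sub>i = 0\<close>, moving in the direction \<open>- e\<^sub>i\<close> leaves the orthant at once.
\<close>

lemma frontier_of_weights:
  "Euclidean_space N frontier_of weights N = {\<omega> \<in> weights N. \<exists>i<N. \<omega> i = 0}"
proof (intro equalityI subsetI)
  fix \<omega> assume \<omega>: "\<omega> \<in> Euclidean_space N frontier_of weights N"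
  let ?U = "(\<Inter>i\<in>{..<N}. {\<omega> \<in> topspace (Euclidean_space N). \<omega> i \<in> {0<..}}) \<inter>
    topspace (Euclidean_space N)"
  have "openin (Euclidean_space N) ?U"
    by (intro openin_INT ballI
        openin_continuous_map_preimage[OF continuous_map_Euclidean_coordinate]) auto
  then have "?U \<subseteq> Euclidean_space N interior_of weights N"
    by (intro interior_of_maximal) (auto simp: weights_def less_imp_le)
  moreover have "\<omega> \<in> weights N" "\<omega> \<notin> Euclidean_space N interior_of weights N"
    using \<omega> closedin_weights by (auto simp: frontier_of_def closure_of_closedin)
  ultimately show "\<omega> \<in> {\<omega> \<in> weights N. \<exists>i<N. \<omega> i = 0}"
    by (force simp: weights_def)
next
  fix \<omega> assume "\<omega> \<in> {\<omega> \<in> weights N. \<exists>i<N. \<omega> i = 0}"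
  then obtain i where \<omega>: "\<omega> \<in> weights N" and i: "i < N" "\<omega> i = 0" by blast
  have "\<omega> \<in> Euclidean_space N closure_of (topspace (Euclidean_space N) - weights N)"
    using \<omega> i by (intro Euclidean_space_closure_ray[where v = "\<lambda>j. if j = i then - 1 else 0"])
      (auto simp: weights_def topspace_Euclidean_space intro!: exI[of _ i])
  moreover have "\<omega> \<in> Euclidean_space N closure_of weights N"
    using \<omega> closedin_weights by (simp add: closure_of_closedin)
  ultimately show "\<omega> \<in> Euclidean_space N frontier_of weights N"
    by (simp add: frontier_of_closures)
qed

lemma Union_groebner_fan_subset: "\<Union>(groebner_fan N I) \<subseteq> weights N"
proof -
  have "groebner_cone N r I \<subseteq> weights N" for r
    unfolding groebner_cone_def by (rule closure_of_minimal[OF _ closedin_weights]) simp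
  then show ?thesis by (auto simp: groebner_fan_def)
qed

section \<open>The example\<close>

text \<open>\<open>expo2 i j\<close> is the exponent of \<open>x\<^sup>iu\<^sup>j\<close>.\<close>

definition expo2 :: "nat \<Rightarrow> nat \<Rightarrow> expo" where
  "expo2 i j = Poly_Mapping.single 0 i + Poly_Mapping.single 1 j"

lemma lookup_expo2: "Poly_Mapping.lookup (expo2 i j) k = (if k = 0 then i else if k = 1 then j else 0)"
  by (auto simp: expo2_def lookup_add lookup_single when_def)

lemma expo2_eq_iff: "expo2 i j = expo2 k l \<longleftrightarrow> i = k \<and> j = l"
  by (metis lookup_expo2 zero_neq_one)

lemma expo2_in_expos: "expo2 i j \<in> expos 2"
  by (auto simp: expos_def in_keys_iff lookup_expo2 split: if_splits)

lemma weight_2: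
  "weight 2 \<omega> \<alpha> = \<omega> 0 * real (Poly_Mapping.lookup \<alpha> 0) + \<omega> 1 * real (Poly_Mapping.lookup \<alpha> 1)"
  by (simp add: weight_def numeral_2_eq_2)

definition slope_weight :: "real \<Rightarrow> nat \<Rightarrow> real" where
  "slope_weight s = (\<lambda>_. 0)(0 := s, 1 := 1)"

text \<open>
  Two exponents of equal weight with different first entries would exhibit \<open>s\<close> as a quotient of
  integers.
\<close>

lemma generic_weight_irrational:
  assumes "0 < s" "s \<notin> \<rat>"
  shows "generic_weight 2 (slope_weight s)"
proof -
  have "\<alpha> = \<beta>" if \<alpha>: "\<alpha> \<in> expos 2" and \<beta>: "\<beta> \<in> expos 2"
    and eq: "s * real (Poly_Mapping.lookup \<alpha> 0) + real (Poly_Mapping.lookup \<alpha> 1) =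
      s * real (Poly_Mapping.lookup \<beta> 0) + real (Poly_Mapping.lookup \<beta> 1)" for \<alpha> \<beta>
  proof -
    have "Poly_Mapping.lookup \<alpha> 0 = Poly_Mapping.lookup \<beta> 0"
    proof (rule ccontr)
      assume "Poly_Mapping.lookup \<alpha> 0 \<noteq> Poly_Mapping.lookup \<beta> 0"
      then have "real (Poly_Mapping.lookup \<alpha> 0) - real (Poly_Mapping.lookup \<beta> 0) \<noteq> 0" by simp
      moreover have "s * (real (Poly_Mapping.lookup \<alpha> 0) - real (Poly_Mapping.lookup \<beta> 0)) =
          real (Poly_Mapping.lookup \<beta> 1) - real (Poly_Mapping.lookup \<alpha> 1)"
        using eq unfolding right_diff_distrib by linarith
      ultimately have "s = (real (Poly_Mapping.lookup \<beta> 1) - real (Poly_Mapping.lookup \<alpha> 1)) /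
          (real (Poly_Mapping.lookup \<alpha> 0) - real (Poly_Mapping.lookup \<beta> 0))"
        by (simp only: nonzero_eq_divide_eq simp_thms)
      then show False using \<open>s \<notin> \<rat>\<close> by (metis Rats_diff Rats_divide Rats_of_nat)
    qed
    then have "Poly_Mapping.lookup \<alpha> i = Poly_Mapping.lookup \<beta> i" if "i < 2" for i
      using eq that by (auto simp: less_2_cases_iff)
    moreover have "Poly_Mapping.lookup \<alpha> i = Poly_Mapping.lookup \<beta> i" if "\<not> i < 2" for i
    proof -
      have "i \<notin> Poly_Mapping.keys \<alpha>" "i \<notin> Poly_Mapping.keys \<beta>"
        using \<alpha> \<beta> that by (auto simp: expos_def)
      then show ?thesis by (simp add: in_keys_iff)
    qed
    ultimately show ?thesis by (meson poly_mapping_eqI)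
  qed
  then show ?thesis using assms by (auto simp: generic_weight_def inj_on_def weight_2 slope_weight_def less_2_cases_iff)
qed

lemma irrational_between:
  fixes a b :: real
  assumes "a < b"
  obtains s where "a < s" "s < b" "s \<notin> \<rat>"
proof -
  have "\<not> {a<..<b} \<subseteq> \<rat>"
    using assms countable_subset countable_rat uncountable_open_interval by blast
  then show ?thesis using that by (meson greaterThanLessThan_iff subsetI)
qed

definition example_poly :: "'a::field mpoly" where
  "example_poly = Poly_Mapping.single (expo2 2 2) 1 + Poly_Mapping.single (expo2 3 0) 1 +
    Poly_Mapping.single (expo2 0 3) 1"

lemma lookup_example_poly:
  "Poly_Mapping.lookup example_poly \<alpha> =
    (if \<alpha> \<in> {expo2 2 2, expo2 3 0, expo2 0 3} then 1 else 0)"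
  by (auto simp: example_poly_def lookup_add lookup_single when_def expo2_eq_iff)

lemma keys_example_poly:
  "Poly_Mapping.keys example_poly = {expo2 2 2, expo2 3 0, expo2 0 3}"
  by (auto simp: in_keys_iff lookup_example_poly split: if_splits)

lemma example_poly_carrier: "example_poly \<in> carrier (mpoly_ring 2)"
  by (simp add: mem_carrier keys_example_poly expo2_in_expos)

text \<open>
  The degree in \<open>x\<close> or the degree in \<open>u\<close> drops from any of the three monomials to any other one.
\<close>

lemma example_nodiv:
  assumes "\<alpha> \<in> {expo2 2 2, expo2 3 0, expo2 0 3}" "\<gamma> \<in> {expo2 2 2, expo2 3 0, expo2 0 3}"
    "\<alpha> \<noteq> \<gamma>"
  shows "\<alpha> \<noteq> \<beta> + \<gamma>"
proof
  assume "\<alpha> = \<beta> + \<gamma>"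
  then have "Poly_Mapping.lookup \<gamma> i \<le> Poly_Mapping.lookup \<alpha> i" for i by (simp add: lookup_add)
  from this[of 0] this[of 1] show False using assms by (auto simp: lookup_expo2)
qed

abbreviation (input) example_ideal :: "'a::field mpoly set" where
  "example_ideal \<equiv> PIdl\<^bsub>mpoly_ring 2\<^esub> example_poly"

lemma weights_2_nonneg: "\<omega> \<in> weights 2 \<Longrightarrow> 0 \<le> \<omega> 0 \<and> 0 \<le> \<omega> 1"
  by (simp add: weights_def)

lemma example_cone:
  assumes s: "0 < s" "s \<notin> \<rat>"
    and \<gamma>: "\<gamma> \<in> {expo2 2 2, expo2 3 0, expo2 0 3}"
    and others: "{expo2 2 2, expo2 3 0, expo2 0 3} - {\<gamma>} = {\<alpha>, \<beta>}"
    and lead: "weight 2 (slope_weight s) \<alpha> < weight 2 (slope_weight s) \<gamma>"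
      "weight 2 (slope_weight s) \<beta> < weight 2 (slope_weight s) \<gamma>"
  shows "groebner_cone 2 (weight_order 2 (slope_weight s)) (example_ideal :: 'a::field mpoly set) =
    Euclidean_space 2 closure_of {\<omega> \<in> weights 2.
      weight 2 \<omega> \<alpha> < weight 2 \<omega> \<gamma> \<and> weight 2 \<omega> \<beta> < weight 2 \<omega> \<gamma>}"
proof -
  have "{\<omega> \<in> weights 2. wlead_ideal 2 \<omega> (example_ideal :: 'a mpoly set) =
      lead_ideal 2 (weight_order 2 (slope_weight s)) example_ideal} =
    {\<omega> \<in> weights 2. \<forall>\<delta>\<in>Poly_Mapping.keys (example_poly :: 'a mpoly) - {\<gamma>}.
      weight 2 \<omega> \<delta> < weight 2 \<omega> \<gamma>}"
  proof (rule open_cone_PIdl)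
    show "generic_weight 2 (slope_weight s)" by (rule generic_weight_irrational[OF s])
    show "example_poly \<in> carrier (mpoly_ring 2)" by (rule example_poly_carrier)
    show "\<gamma> \<in> Poly_Mapping.keys (example_poly :: 'a mpoly)"
      "Poly_Mapping.lookup (example_poly :: 'a mpoly) \<gamma> = 1"
      using \<gamma> by (auto simp: keys_example_poly lookup_example_poly)
    fix \<delta> assume "\<delta> \<in> Poly_Mapping.keys (example_poly :: 'a mpoly)" "\<delta> \<noteq> \<gamma>"
    then have \<delta>: "\<delta> \<in> {expo2 2 2, expo2 3 0, expo2 0 3} - {\<gamma>}" by (simp add: keys_example_poly)
    then show "weight 2 (slope_weight s) \<delta> < weight 2 (slope_weight s) \<gamma>"
      using lead unfolding others by blast
    show "\<delta> \<noteq> \<epsilon> + \<gamma>" for \<epsilon> using \<delta> example_nodiv[OF _ \<gamma>] by blast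
  qed
  then show ?thesis by (simp add: groebner_cone_def keys_example_poly others)
qed

lemma example_cone_x2u2:
  assumes "1 / 2 < s" "s < 2" "s \<notin> \<rat>"
  shows "groebner_cone 2 (weight_order 2 (slope_weight s)) (example_ideal :: 'a::field mpoly set) =
    Euclidean_space 2 closure_of {\<omega> \<in> weights 2. \<omega> 0 < 2 * \<omega> 1 \<and> \<omega> 1 < 2 * \<omega> 0}"
proof -
  have "groebner_cone 2 (weight_order 2 (slope_weight s)) (example_ideal :: 'a mpoly set) =
    Euclidean_space 2 closure_of {\<omega> \<in> weights 2.
      weight 2 \<omega> (expo2 3 0) < weight 2 \<omega> (expo2 2 2) \<and> weight 2 \<omega> (expo2 0 3) < weight 2 \<omega> (expo2 2 2)}"
    using assms
    by (intro example_cone) (auto simp: weight_2 lookup_expo2 slope_weight_def expo2_eq_iff)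
  also have "{\<omega> \<in> weights 2. weight 2 \<omega> (expo2 3 0) < weight 2 \<omega> (expo2 2 2) \<and>
      weight 2 \<omega> (expo2 0 3) < weight 2 \<omega> (expo2 2 2)} =
    {\<omega> \<in> weights 2. \<omega> 0 < 2 * \<omega> 1 \<and> \<omega> 1 < 2 * \<omega> 0}"
    by (intro Collect_cong conj_cong refl)
      (auto simp: weight_2 lookup_expo2)
  finally show ?thesis .
qed

lemma example_cone_x3:
  assumes "2 < s" "s \<notin> \<rat>"
  shows "groebner_cone 2 (weight_order 2 (slope_weight s)) (example_ideal :: 'a::field mpoly set) =
    Euclidean_space 2 closure_of {\<omega> \<in> weights 2. 2 * \<omega> 1 < \<omega> 0}"
proof -
  have "groebner_cone 2 (weight_order 2 (slope_weight s)) (example_ideal :: 'a mpoly set) =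
    Euclidean_space 2 closure_of {\<omega> \<in> weights 2.
      weight 2 \<omega> (expo2 2 2) < weight 2 \<omega> (expo2 3 0) \<and> weight 2 \<omega> (expo2 0 3) < weight 2 \<omega> (expo2 3 0)}"
    using assms
    by (intro example_cone) (auto simp: weight_2 lookup_expo2 slope_weight_def expo2_eq_iff)
  also have "{\<omega> \<in> weights 2. weight 2 \<omega> (expo2 2 2) < weight 2 \<omega> (expo2 3 0) \<and>
      weight 2 \<omega> (expo2 0 3) < weight 2 \<omega> (expo2 3 0)} =
    {\<omega> \<in> weights 2. 2 * \<omega> 1 < \<omega> 0}"
    by (intro Collect_cong conj_cong refl)
      (auto simp: weight_2 lookup_expo2 dest: weights_2_nonneg)
  finally show ?thesis .
qed

lemma example_cone_u3:
  assumes "0 < s" "s < 1 / 2" "s \<notin> \<rat>"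
  shows "groebner_cone 2 (weight_order 2 (slope_weight s)) (example_ideal :: 'a::field mpoly set) =
    Euclidean_space 2 closure_of {\<omega> \<in> weights 2. 2 * \<omega> 0 < \<omega> 1}"
proof -
  have "groebner_cone 2 (weight_order 2 (slope_weight s)) (example_ideal :: 'a mpoly set) =
    Euclidean_space 2 closure_of {\<omega> \<in> weights 2.
      weight 2 \<omega> (expo2 2 2) < weight 2 \<omega> (expo2 0 3) \<and> weight 2 \<omega> (expo2 3 0) < weight 2 \<omega> (expo2 0 3)}"
    using assms
    by (intro example_cone) (auto simp: weight_2 lookup_expo2 slope_weight_def expo2_eq_iff)
  also have "{\<omega> \<in> weights 2. weight 2 \<omega> (expo2 2 2) < weight 2 \<omega> (expo2 0 3) \<and>
      weight 2 \<omega> (expo2 3 0) < weight 2 \<omega> (expo2 0 3)} =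
    {\<omega> \<in> weights 2. 2 * \<omega> 0 < \<omega> 1}"
    by (intro Collect_cong conj_cong refl)
      (auto simp: weight_2 lookup_expo2 dest: weights_2_nonneg)
  finally show ?thesis .
qed

lemma cone_in_groebner_fan:
  "generic_weight N \<omega> \<Longrightarrow> groebner_cone N (weight_order N \<omega>) I \<in> groebner_fan N I"
  unfolding groebner_fan_def using monomial_order_weight_order by blast

text \<open>
  The three open cones leave out only the two rays on the lines \<open>a = 2b\<close> and \<open>b = 2a\<close>. A point of
  a closed outer cone becomes a point of the open one when the dominant coordinate is increased.
\<close>

lemma Union_example_fan: "\<Union>(groebner_fan 2 (example_ideal :: 'a::field mpoly set)) = weights 2"
proof (rule equalityI[OF Union_groebner_fan_subset])
  let ?F = "groebner_fan 2 (example_ideal :: 'a mpoly set)"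
  have x2u2: "Euclidean_space 2 closure_of {\<omega> \<in> weights 2. \<omega> 0 < 2 * \<omega> 1 \<and> \<omega> 1 < 2 * \<omega> 0} \<in> ?F"
  proof -
    obtain s :: real where s: "1 / 2 < s" "s < 2" "s \<notin> \<rat>"
      using irrational_between[of "1 / 2" "2"] by auto
    show ?thesis
      unfolding example_cone_x2u2[OF s(1,2,3), where ?'a = 'a, symmetric]
      using s by (intro cone_in_groebner_fan generic_weight_irrational) auto
  qed
  have x3: "Euclidean_space 2 closure_of {\<omega> \<in> weights 2. 2 * \<omega> 1 < \<omega> 0} \<in> ?F"
  proof -
    obtain s :: real where s: "2 < s" "s < 3" "s \<notin> \<rat>"
      using irrational_between[of "2" "3"] by auto
    show ?thesis
      unfolding example_cone_x3[OF s(1,3), where ?'a = 'a, symmetric]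
      using s by (intro cone_in_groebner_fan generic_weight_irrational) auto
  qed
  have u3: "Euclidean_space 2 closure_of {\<omega> \<in> weights 2. 2 * \<omega> 0 < \<omega> 1} \<in> ?F"
  proof -
    obtain s :: real where s: "0 < s" "s < 1 / 2" "s \<notin> \<rat>"
      using irrational_between[of "0" "1 / 2"] by auto
    show ?thesis
      unfolding example_cone_u3[OF s, where ?'a = 'a, symmetric]
      using s by (intro cone_in_groebner_fan generic_weight_irrational) auto
  qed
  show "weights 2 \<subseteq> \<Union>?F"
  proof
    fix \<omega> assume \<omega>: "\<omega> \<in> weights 2"
    then have top: "\<omega> \<in> topspace (Euclidean_space 2)" by (simp add: weights_def)
    consider "\<omega> 0 < 2 * \<omega> 1" "\<omega> 1 < 2 * \<omega> 0" | "2 * \<omega> 1 \<le> \<omega> 0" | "2 * \<omega> 0 \<le> \<omega> 1" by linarith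
    then show "\<omega> \<in> \<Union>?F"
    proof cases
      case 1
      then have "\<omega> \<in> Euclidean_space 2 closure_of {\<omega> \<in> weights 2. \<omega> 0 < 2 * \<omega> 1 \<and> \<omega> 1 < 2 * \<omega> 0}"
        using \<omega> top by (intro subsetD[OF closure_of_subset_Int]) simp
      then show ?thesis using x2u2 by blast
    next
      case 2
      then have "\<omega> \<in> Euclidean_space 2 closure_of {\<omega> \<in> weights 2. 2 * \<omega> 1 < \<omega> 0}"
        using \<omega> top
        by (intro Euclidean_space_closure_ray[where v = "\<lambda>i. if i = 0 then 1 else 0"])
          (auto simp: weights_def topspace_Euclidean_space)
      then show ?thesis using x3 by blast
    next
      case 3
      then have "\<omega> \<in> Euclidean_space 2 closure_of {\<omega> \<in> weights 2. 2 * \<omega> 0 < \<omega> 1}"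
        using \<omega> top
        by (intro Euclidean_space_closure_ray[where v = "\<lambda>i. if i = 1 then 1 else 0"])
          (auto simp: weights_def topspace_Euclidean_space)
      then show ?thesis using u3 by blast
    qed
  qed
qed

theorem lemma4p1:
  shows "\<exists>(n::nat) (m::nat) (I :: 'a::field mpoly set) r.
    n \<ge> 1 \<and> m \<ge> 1 \<and>
    ideal I (mpoly_ring (n + m)) \<and>
    specific_elimination_order n m I r \<and>
    groebner_cone (n + m) r I \<inter> fan_boundary (n + m) (groebner_fan (n + m) I) = {\<lambda>_. 0}"
proof -
  interpret cring "mpoly_ring 2 :: 'a mpoly ring" by (rule mpoly_ring_cring)
  let ?I = "example_ideal :: 'a mpoly set" and ?f = "example_poly :: 'a mpoly"
  obtain s :: real where s: "1 / 2 < s" "s < 2" "s \<notin> \<rat>" using irrational_between[of "1/2" 2] by auto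
  let ?r = "weight_order 2 (slope_weight s)"
  have gen: "generic_weight 2 (slope_weight s)" using s by (intro generic_weight_irrational) auto
  have "wlead_form 2 (slope_weight s) ?f =
      Poly_Mapping.single (expo2 2 2) (Poly_Mapping.lookup ?f (expo2 2 2))"
    using s by (intro wlead_form_eq_single)
      (auto simp: keys_example_poly weight_2 lookup_expo2 slope_weight_def)
  moreover have "?f \<noteq> 0" using keys_example_poly[where ?'a = 'a] by auto
  ultimately have lt: "lead_term ?r ?f = Poly_Mapping.single (expo2 2 2) 1"
    by (simp add: lead_term_eq_wlead_form[OF gen _ example_poly_carrier] lookup_example_poly)
  then have "lead_coef ?r ?f = 1"
    unfolding lead_term_def by (metis lookup_single_eq lookup_single_not_eq zero_neq_one)
  then have GB: "GB 2 ?r ?I = {?f}" by (rule GB_PIdl[OF gen example_poly_carrier])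
  have "lead_term ?r ?f \<notin> carrier (mpoly_ring 1)"
    by (auto simp: lt mem_carrier expos_def subset_iff in_keys_iff lookup_expo2 intro!: exI[of _ 1])
  then have elim: "specific_elimination_order 1 1 ?I ?r"
    using monomial_order_weight_order[OF gen]
    unfolding specific_elimination_order_def one_add_one GB by blast
  let ?C = "{\<omega> \<in> weights 2. \<omega> 0 < 2 * \<omega> 1 \<and> \<omega> 1 < 2 * \<omega> 0}"
  (* The cone lies in the closed sector K, which touches the axes in the origin only. *)
  let ?K = "{\<omega> \<in> topspace (Euclidean_space 2). 2 * \<omega> 1 - \<omega> 0 \<in> {0..}} \<inter>
    {\<omega> \<in> topspace (Euclidean_space 2). 2 * \<omega> 0 - \<omega> 1 \<in> {0..}}"
  have cone: "groebner_cone 2 ?r ?I = Euclidean_space 2 closure_of ?C"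
    by (rule example_cone_x2u2[OF s])
  have "closedin (Euclidean_space 2) ?K"
    by (intro closedin_Int closedin_halfplane)
  then have "Euclidean_space 2 closure_of ?C \<subseteq> ?K"
    by (intro closure_of_minimal) (auto simp: weights_def)
  then have sub: "\<omega> = (\<lambda>_. 0)"
    if "\<omega> \<in> Euclidean_space 2 closure_of ?C" "\<omega> \<in> weights 2" "i < 2" "\<omega> i = 0" for \<omega> i
  proof -
    have "0 \<le> \<omega> 0" "0 \<le> \<omega> 1" "\<omega> 0 \<le> 2 * \<omega> 1" "\<omega> 1 \<le> 2 * \<omega> 0" "\<forall>j\<ge>2. \<omega> j = 0"
      using that \<open>_ \<subseteq> ?K\<close> by (auto simp: weights_def topspace_Euclidean_space)
    moreover have "\<omega> 0 = 0 \<or> \<omega> 1 = 0" using that(3,4) by (auto simp: less_2_cases_iff)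
    ultimately have "\<omega> j = 0" for j by (cases "j \<ge> 2") (auto simp: not_le less_2_cases_iff)
    then show ?thesis by blast
  qed
  (* The origin is the limit of the points (t, t) of the open cone. *)
  have "(\<lambda>_. 0) \<in> Euclidean_space 2 closure_of ?C"
    by (rule Euclidean_space_closure_ray[where v = "\<lambda>i. if i < 2 then 1 else 0"])
      (auto simp: weights_def topspace_Euclidean_space)
  moreover have "fan_boundary 2 (groebner_fan 2 ?I) = {\<omega> \<in> weights 2. \<exists>i<2. \<omega> i = 0}"
    by (simp add: fan_boundary_def Union_example_fan frontier_of_weights)
  ultimately have "groebner_cone 2 ?r ?I \<inter> fan_boundary 2 (groebner_fan 2 ?I) = {\<lambda>_. 0}"
    unfolding cone using sub
    by (auto simp: weights_def topspace_Euclidean_space intro!: exI[of _ 0])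
  moreover have "ideal ?I (mpoly_ring 2)" by (rule cgenideal_ideal[OF example_poly_carrier])
  ultimately show ?thesis
    using elim
    by (intro exI[of _ 1] exI[of _ ?I] exI[of _ ?r]) (simp only: one_add_one order_refl simp_thms)
qed

end
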